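(* Let $\mathcal{G}$ be a class of graphs that has a characterization by forbidden induced subgraphs, i.e. there is a family $\mathcal{F}$ of graphs such that a graph $G$ belongs to $\mathcal{G}$ if and only if $G$ has no induced subgraph isomorphic to a member of $\mathcal{F}$. Let $\mathcal{P}=\{P : P \text{ is a finite poset with } G_P\in\mathcal{G}\}$. Then $\mathcal{P}$ has a characterization by forbidden $\prec$-preserving subposets, i.e. there is a family $\{Q_i\}_{i\in I}$ of finite posets such that a finite poset $P$ belongs to $\mathcal{P}$ if and only if $P$ contains no $\prec$-preserving subposet isomorphic to any $Q_i$.
   Context: All posets are finite. For a poset $P=(V,\leq)$: $u<v$ means $u\leq v$ and $u\neq v$; $u\prec v$ ($v$ covers $u$) means $u<v$ and there is no $z\in V$ with $u<z<v$; $u\parallel v$ means $u$ and $v$ are incomparable. The cover-incomparability graph $G_P$ of $P$ is the graph with vertex set $V$ in which distinct $u,v$ are adjacent iff $u\prec v$, or $v\prec u$, or $u\parallel v$. A poset $Q=(V_Q,\leq_Q)$ is a $\prec$-preserving subposet of $P=(V_P,\leq_P)$ if $V_Q\subseteq V_P$, for all $u,v\in V_Q$ we have $u\leq_Q v\Leftrightarrow u\leq_P v$, and for all $u,v\in V_Q$ we have $u\prec_Q v\Leftrightarrow u\prec_P v$ (covering taken in $Q$ and in $P$ respectively). *)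

theory Defs
  imports
    "Graph_Theory.Digraph_Component"
    "Graph_Theory.Digraph_Isomorphism"
    "Graph_Theory.Pair_Digraph"
begin

text \<open>
  A poset \<open>(V, \<le>)\<close> is represented by its reflexive order relation \<open>r\<close> alone: by reflexivity
  \<open>V = Field r\<close>, and \<open>u \<le> v\<close> is \<open>(u, v) \<in> r\<close>.
\<close>

definition finite_poset :: "'a rel \<Rightarrow> bool" where
  "finite_poset r \<longleftrightarrow> Partial_order r \<and> finite (Field r)"

definition less_in :: "'a rel \<Rightarrow> 'a \<Rightarrow> 'a \<Rightarrow> bool" where
  "less_in r u v \<longleftrightarrow> (u, v) \<in> r \<and> u \<noteq> v"

definition covered_by :: "'a rel \<Rightarrow> 'a \<Rightarrow> 'a \<Rightarrow> bool" where
  "covered_by r u v \<longleftrightarrow> less_in r u v \<and> \<not> (\<exists>z\<in>Field r. less_in r u z \<and> less_in r z v)"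

definition incomparable :: "'a rel \<Rightarrow> 'a \<Rightarrow> 'a \<Rightarrow> bool" where
  "incomparable r u v \<longleftrightarrow> (u, v) \<notin> r \<and> (v, u) \<notin> r"

text \<open>
  Finite simple graphs are the library's \<^const>\<open>pair_graph\<close>s: finite, loopfree, with a symmetric
  set of arcs, each edge being represented by its two opposite arcs.
\<close>

definition cover_incomparability_graph :: "'a rel \<Rightarrow> 'a pair_pre_digraph" where
  "cover_incomparability_graph r =
     \<lparr> pverts = Field r,
       parcs = {(u, v). u \<in> Field r \<and> v \<in> Field r \<and> u \<noteq> v \<and>
                  (covered_by r u v \<or> covered_by r v u \<or> incomparable r u v)} \<rparr>"

lemma pair_graph_cover_incomparability_graph:
  assumes "finite_poset r"
  shows "pair_graph (cover_incomparability_graph r)"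
proof -
  let ?G = "cover_incomparability_graph r"
  have fin: "finite (Field r)"
    using assms by (simp add: finite_poset_def)
  have "parcs ?G \<subseteq> Field r \<times> Field r"
    by (auto simp: cover_incomparability_graph_def)
  then have fin_arcs: "finite (parcs ?G)"
    using fin by (meson finite_SigmaI finite_subset)
  have "sym (parcs ?G)"
    by (auto simp: cover_incomparability_graph_def incomparable_def sym_def)
  then show ?thesis
    using fin fin_arcs
    by unfold_locales (auto simp: cover_incomparability_graph_def symmetric_def)
qed

definition contains_induced :: "'a pair_pre_digraph \<Rightarrow> 'b pair_pre_digraph \<Rightarrow> bool" where
  "contains_induced G H \<longleftrightarrow>
     (\<exists>K. pair_graph K \<and> induced_subgraph (with_proj K) (with_proj G)
        \<and> digraph_iso (with_proj K) (with_proj H))"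

definition forbidden_induced_subgraph_characterization ::
    "'a pair_pre_digraph set \<Rightarrow> 'b pair_pre_digraph set \<Rightarrow> bool" where
  "forbidden_induced_subgraph_characterization \<G> \<F> \<longleftrightarrow>
     (\<forall>H\<in>\<F>. pair_graph H) \<and>
     (\<forall>G. pair_graph G \<longrightarrow> (G \<in> \<G> \<longleftrightarrow> \<not> (\<exists>H\<in>\<F>. contains_induced G H)))"

definition cover_preserving_subposet :: "'a rel \<Rightarrow> 'a rel \<Rightarrow> bool" where
  "cover_preserving_subposet q p \<longleftrightarrow>
     Partial_order q \<and> Partial_order p \<and> Field q \<subseteq> Field p \<and>
     (\<forall>u\<in>Field q. \<forall>v\<in>Field q. (u, v) \<in> q \<longleftrightarrow> (u, v) \<in> p) \<and>
     (\<forall>u\<in>Field q. \<forall>v\<in>Field q. covered_by q u v \<longleftrightarrow> covered_by p u v)"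

text \<open>
  \<^const>\<open>iso\<close> is stated through \<^const>\<open>embed\<close>, but it is order isomorphism for arbitrary relations,
  not only for well-orders (\<open>iso_iff2\<close>).
\<close>

definition contains_cover_preserving :: "'a rel \<Rightarrow> 'b rel \<Rightarrow> bool" where
  "contains_cover_preserving p q \<longleftrightarrow> (\<exists>s. cover_preserving_subposet s p \<and> (\<exists>f. iso s q f))"

definition forbidden_cover_preserving_subposet_characterization ::
    "'a rel set \<Rightarrow> 'b rel set \<Rightarrow> bool" where
  "forbidden_cover_preserving_subposet_characterization \<P> \<Q> \<longleftrightarrow>
     (\<forall>q\<in>\<Q>. finite_poset q) \<and>
     (\<forall>p. finite_poset p \<longrightarrow> (p \<in> \<P> \<longleftrightarrow> \<not> (\<exists>q\<in>\<Q>. contains_cover_preserving p q)))"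

end

theory Submission
  imports Defs
begin

text \<open>
  The forbidden posets are the posets on natural numbers whose cover-incomparability graph has an
  induced subgraph in \<open>\<F>\<close>. Adjacency of two elements depends only on how they are related by the
  order and by covering, so a cover-preserving subposet of \<open>P\<close> has as its graph an induced subgraph
  of that of \<open>P\<close>, and it passes its forbidden induced subgraphs on to \<open>P\<close>. Conversely, a finite poset
  outside \<open>\<P>\<close> contains a forbidden poset, namely a copy of itself.
\<close>

section \<open>Induced subgraphs as embeddings\<close>

text \<open>\<open>contains_induced\<close> speaks of an intermediate subgraph and of an isomorphism
  with a separate map on arcs. A single vertex map, from the pattern into the host, composes
  directly, also across vertex types.\<close>

definition induced_embedding :: "('b \<Rightarrow> 'a) \<Rightarrow> 'b pair_pre_digraph \<Rightarrow> 'a pair_pre_digraph \<Rightarrow> bool" where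
  "induced_embedding f H G \<longleftrightarrow>
     inj_on f (pverts H) \<and> f ` pverts H \<subseteq> pverts G \<and>
     (\<forall>u\<in>pverts H. \<forall>v\<in>pverts H. (u, v) \<in> parcs H \<longleftrightarrow> (f u, f v) \<in> parcs G)"

lemma induced_embedding_comp:
  assumes "induced_embedding f H G" and "induced_embedding g G K"
  shows "induced_embedding (g \<circ> f) H K"
  unfolding induced_embedding_def
proof (intro conjI ballI)
  have sub: "f ` pverts H \<subseteq> pverts G"
    using assms(1) by (simp add: induced_embedding_def)
  show "inj_on (g \<circ> f) (pverts H)"
    using assms sub by (auto simp: induced_embedding_def intro!: comp_inj_on intro: inj_on_subset)
  show "(g \<circ> f) ` pverts H \<subseteq> pverts K"
    using assms by (simp add: induced_embedding_def image_subset_iff)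
  show "(u, v) \<in> parcs H \<longleftrightarrow> ((g \<circ> f) u, (g \<circ> f) v) \<in> parcs K"
    if "u \<in> pverts H" "v \<in> pverts H" for u v
    using assms sub that by (simp add: induced_embedding_def image_subset_iff)
qed

text \<open>Tails and heads are the pair projections on both sides, so the arc map of the
  isomorphism is forced by its vertex map, whose inverse is the embedding.\<close>

lemma contains_induced_imp_embedding:
  assumes "contains_induced G H"
  obtains f where "induced_embedding f H G"
proof -
  obtain K \<phi> where ind: "induced_subgraph (with_proj K) (with_proj G)"
    and iso: "pre_digraph.digraph_isomorphism (with_proj K) \<phi>"
    and H: "with_proj H = app_iso \<phi> (with_proj K)"
    using assms by (auto simp: contains_induced_def digraph_iso_def)
  define g where "g = iso_verts \<phi>"
  have KG: "pverts K \<subseteq> pverts G"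
    and arcs_K: "parcs K = {e \<in> parcs G. fst e \<in> pverts K \<and> snd e \<in> pverts K}"
    using ind by (auto simp: induced_subgraph_def subgraph_def)
  have inj: "inj_on g (pverts K)"
    and ends: "\<And>a. a \<in> parcs K \<Longrightarrow>
      g (fst a) = iso_tail \<phi> (iso_arcs \<phi> a) \<and> g (snd a) = iso_head \<phi> (iso_arcs \<phi> a)"
    using iso by (auto simp: pre_digraph.digraph_isomorphism_def g_def)
  \<comment> \<open>Comparing the record fields of \<open>H\<close> yields the projections:
    \<open>app_iso\<close> installs \<open>iso_tail\<close> and \<open>iso_head\<close> as the new
    tail and head.\<close>
  have verts_H: "pverts H = g ` pverts K" and arcs_H: "parcs H = iso_arcs \<phi> ` parcs K"
    and proj: "iso_tail \<phi> = fst" "iso_head \<phi> = snd"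
    using H by (simp_all add: with_proj_def app_iso_def g_def)
  have "iso_arcs \<phi> a = map_prod g g a" if "a \<in> parcs K" for a
    using ends[OF that] proj by (simp add: prod_eq_iff)
  then have arcs_H': "parcs H = map_prod g g ` parcs K"
    by (simp add: arcs_H)
  have arc_iff: "(g u, g v) \<in> parcs H \<longleftrightarrow> (u, v) \<in> parcs G"
    if "u \<in> pverts K" "v \<in> pverts K" for u v
  proof
    assume "(g u, g v) \<in> parcs H"
    then obtain a where "a \<in> parcs K" "g (fst a) = g u" "g (snd a) = g v"
      unfolding arcs_H' by auto
    then show "(u, v) \<in> parcs G"
      using that inj arcs_K by (metis (mono_tags, lifting) inj_onD mem_Collect_eq prod.collapse)
  next
    assume "(u, v) \<in> parcs G"
    with that have "(u, v) \<in> parcs K" by (simp add: arcs_K)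
    then show "(g u, g v) \<in> parcs H" unfolding arcs_H' by force
  qed
  \<comment> \<open>The isomorphism leads from the subgraph \<open>K\<close> to the pattern, hence
    the inverse.\<close>
  let ?f = "the_inv_into (pverts K) g"
  have "induced_embedding ?f H G"
    unfolding induced_embedding_def verts_H
    using inj KG by (auto simp: the_inv_into_f_f arc_iff inj_on_the_inv_into)
  then show ?thesis by (rule that)
qed

text \<open>The witness is the subgraph of \<open>G\<close> induced on the image of
  \<open>f\<close>; the inverse of \<open>f\<close> maps it isomorphically onto
  \<open>H\<close>.\<close>

lemma induced_embedding_imp_contains:
  assumes G: "pair_graph G" and H: "pair_graph H" and f: "induced_embedding f H G"
  shows "contains_induced G H"
proof -
  interpret G: pair_graph G by (rule G)
  interpret H: pair_graph H by (rule H)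
  have inj: "inj_on f (pverts H)" and sub: "f ` pverts H \<subseteq> pverts G"
    and arc_iff: "\<And>u v. u \<in> pverts H \<Longrightarrow> v \<in> pverts H \<Longrightarrow>
      (u, v) \<in> parcs H \<longleftrightarrow> (f u, f v) \<in> parcs G"
    using f by (auto simp: induced_embedding_def)
  define K where "K = \<lparr>pverts = f ` pverts H,
    parcs = {e \<in> parcs G. fst e \<in> f ` pverts H \<and> snd e \<in> f ` pverts H}\<rparr>"
  have "symmetric (with_proj K)"
    using G.pair_sym_arcs by (auto simp: symmetric_def K_def sym_def)
  then have K: "pair_graph K"
    using G.pair_no_loops H.pair_finite_verts G.pair_finite_arcs
    by unfold_locales (auto simp: K_def)
  interpret K: pair_graph K by (rule K)
  have ind: "induced_subgraph (with_proj K) (with_proj G)"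
    using sub G.wf_digraph_axioms K.wf_digraph_axioms
    by (auto simp: induced_subgraph_def subgraph_def compatible_def K_def)
  let ?g = "the_inv_into (pverts H) f"
  \<comment> \<open>The arc map acts on both ends by the inverse of \<open>f\<close>;
    \<open>fst\<close> and \<open>snd\<close> are chosen so that \<open>app_iso\<close> gives a
    graph of the form \<open>with_proj\<close>.\<close>
  define \<phi> where
    "\<phi> = \<lparr>iso_verts = ?g, iso_arcs = map_prod ?g ?g, iso_head = snd, iso_tail = fst\<rparr>"
  have g_f: "?g (f u) = u" if "u \<in> pverts H" for u
    using inj that by (rule the_inv_into_f_f)
  have inj_g: "inj_on ?g (pverts K)"
    using inj by (simp add: K_def inj_on_the_inv_into)
  have arcs_sub: "parcs K \<subseteq> pverts K \<times> pverts K"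
    by (auto simp: K_def)
  have "inj_on (map_prod ?g ?g) (parcs K)"
    using map_prod_inj_on[OF inj_g inj_g] arcs_sub by (rule inj_on_subset)
  then have iso: "pre_digraph.digraph_isomorphism (with_proj K) \<phi>"
    using inj_g K.wf_digraph_axioms by (simp add: pre_digraph.digraph_isomorphism_def \<phi>_def)
  have verts: "?g ` pverts K = pverts H"
    by (force simp: K_def g_f)
  have arcs: "map_prod ?g ?g ` parcs K = parcs H"
  proof (intro set_eqI iffI)
    fix e assume "e \<in> map_prod ?g ?g ` parcs K"
    then show "e \<in> parcs H" by (auto simp: K_def g_f arc_iff)
  next
    fix e assume e: "e \<in> parcs H"
    obtain u v where uv: "e = (u, v)" by fastforce
    with e have "u \<in> pverts H" "v \<in> pverts H"
      by (auto dest: H.in_arcsD1 H.in_arcsD2)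
    with e uv have "(f u, f v) \<in> parcs K" "e = map_prod ?g ?g (f u, f v)"
      by (auto simp: K_def g_f arc_iff)
    then show "e \<in> map_prod ?g ?g ` parcs K" by blast
  qed
  have "with_proj H = app_iso \<phi> (with_proj K)"
    by (simp add: with_proj_def app_iso_def \<phi>_def verts[unfolded with_proj_def] arcs)
  with iso have "digraph_iso (with_proj K) (with_proj H)"
    unfolding digraph_iso_def by blast
  with K ind show ?thesis by (auto simp: contains_induced_def)
qed

lemma contains_induced_embedding_trans:
  assumes "contains_induced G H" and "induced_embedding g G G'"
    and "pair_graph G'" and "pair_graph H"
  shows "contains_induced G' H"
  using assms
  by (meson contains_induced_imp_embedding induced_embedding_comp induced_embedding_imp_contains)

section \<open>Cover-preserving subposets\<close>

text \<open>Injectivity of \<open>f\<close> preserves strictness, and surjectivity onto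
  \<open>Field s\<close> pulls every intermediate element back to \<open>r\<close>.\<close>

lemma iso_covered_by_iff:
  assumes iso: "iso r s f" and uv: "u \<in> Field r" "v \<in> Field r"
  shows "covered_by s (f u) (f v) \<longleftrightarrow> covered_by r u v"
proof -
  have Field_s: "Field s = f ` Field r"
    using iso by (auto simp: iso_iff2 bij_betw_def)
  have "less_in s (f x) (f y) \<longleftrightarrow> less_in r x y" if "x \<in> Field r" "y \<in> Field r" for x y
    using iso that by (auto simp: iso_iff2 bij_betw_def less_in_def dest: inj_onD)
  then show ?thesis
    using uv by (auto simp: covered_by_def Field_s)
qed

lemma iso_incomparable_iff:
  assumes "iso r s f" and "u \<in> Field r" and "v \<in> Field r"
  shows "incomparable s (f u) (f v) \<longleftrightarrow> incomparable r u v"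
  using assms by (simp add: iso_iff2 incomparable_def)

lemma iso_imp_induced_embedding:
  assumes "iso r s f"
  shows "induced_embedding f (cover_incomparability_graph r) (cover_incomparability_graph s)"
proof -
  have "inj_on f (Field r)" and "f ` Field r = Field s"
    using assms by (auto simp: iso_iff2 bij_betw_def)
  then show ?thesis
    using iso_covered_by_iff[OF assms] iso_incomparable_iff[OF assms]
    by (auto simp: induced_embedding_def cover_incomparability_graph_def dest: inj_onD)
qed

text \<open>\<open>contains_cover_preserving\<close> supplies an isomorphism from the subposet to
  the pattern; embedding the pattern requires the opposite direction.\<close>

lemma iso_inv_into:
  assumes "iso r s f"
  shows "iso s r (inv_into (Field r) f)"
proof -
  have bij: "bij_betw f (Field r) (Field s)"
    and rel: "\<And>a b. a \<in> Field r \<Longrightarrow> b \<in> Field r \<Longrightarrow> (a, b) \<in> r \<longleftrightarrow> (f a, f b) \<in> s"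
    using assms by (auto simp: iso_iff2)
  then show ?thesis
    using bij_betw_inv_into[OF bij]
    by (auto simp: iso_iff2 bij_betw_inv_into_right bij_betw_apply)
qed

text \<open>In a mere suborder, a cover may acquire intermediate elements in \<open>p\<close> and so
  lose its edge. Agreement on covers rules this out, and agreement on the order settles
  incomparability.\<close>

lemma cover_preserving_subposet_imp_induced_embedding:
  assumes "cover_preserving_subposet s p"
  shows "induced_embedding id (cover_incomparability_graph s) (cover_incomparability_graph p)"
  using assms
  by (auto simp: cover_preserving_subposet_def induced_embedding_def
      cover_incomparability_graph_def incomparable_def)

lemma contains_cover_preserving_imp_induced_embedding:
  assumes "contains_cover_preserving p q"
  obtains g where
    "induced_embedding g (cover_incomparability_graph q) (cover_incomparability_graph p)"
  using assms unfolding contains_cover_preserving_def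
  by (meson cover_preserving_subposet_imp_induced_embedding induced_embedding_comp
      iso_imp_induced_embedding iso_inv_into)

text \<open>This lets a forbidden family over one fixed type serve posets over any type.\<close>

lemma finite_poset_iso_nat:
  fixes p :: "'a rel"
  assumes "finite_poset p"
  obtains q :: "nat rel" and f where "finite_poset q" and "iso p q f"
proof -
  have po: "Partial_order p" and fin: "finite (Field p)"
    using assms by (auto simp: finite_poset_def)
  obtain f :: "'a \<Rightarrow> nat" where inj: "inj_on f (Field p)"
    using finite_imp_inj_to_nat_seg[OF fin] by blast
  define q where "q = map_prod f f ` p"
  have Field_q: "Field q = f ` Field p"
    by (force simp: q_def Field_def)
  have rel: "(f a, f b) \<in> q \<longleftrightarrow> (a, b) \<in> p" if "a \<in> Field p" "b \<in> Field p" for a b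
    using inj that by (auto simp: q_def dest: inj_onD FieldI1 FieldI2)
  have p_refl: "\<And>a. a \<in> Field p \<Longrightarrow> (a, a) \<in> p" and p_trans: "trans p" and p_antisym: "antisym p"
    using po by (auto simp: order_on_defs refl_on_def)
  \<comment> \<open>Since \<open>f\<close> is injective only on \<open>Field p\<close>, preimages
    must be taken there before \<open>rel\<close> applies.\<close>
  have q_elim: "\<exists>a\<in>Field p. \<exists>b\<in>Field p. x = f a \<and> y = f b" if "(x, y) \<in> q" for x y
    using that by (force simp: q_def intro: FieldI1 FieldI2)
  have "refl_on (Field q) q"
    using p_refl by (auto simp: refl_on_def Field_q rel)
  moreover have "trans q"
  proof (rule transI)
    fix x y z assume xy: "(x, y) \<in> q" and yz: "(y, z) \<in> q"
    obtain a b where ab: "a \<in> Field p" "b \<in> Field p" "x = f a" "y = f b"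
      using q_elim[OF xy] by blast
    \<comment> \<open>Only \<open>z\<close> needs a new preimage: \<open>b\<close> already
      represents \<open>y\<close>, so both pairs meet at the same element of
      \<open>p\<close>.\<close>
    obtain c where c: "c \<in> Field p" "z = f c"
      using q_elim[OF yz] by blast
    show "(x, z) \<in> q"
      using xy yz ab c p_trans by (auto simp: rel dest: transD)
  qed
  moreover have "antisym q"
  proof (rule antisymI)
    fix x y assume xy: "(x, y) \<in> q" and yx: "(y, x) \<in> q"
    obtain a b where ab: "a \<in> Field p" "b \<in> Field p" "x = f a" "y = f b"
      using q_elim[OF xy] by blast
    show "x = y"
      using xy yx ab p_antisym by (auto simp: rel dest: antisymD)
  qed
  ultimately have "Partial_order q"
    by (auto simp: order_on_defs Field_def)
  then have "finite_poset q"
    using fin by (simp add: finite_poset_def Field_q)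
  moreover have "iso p q f"
    using inj by (simp add: iso_iff2 bij_betw_def Field_q rel)
  ultimately show ?thesis by (rule that)
qed

theorem theorem1:
  fixes \<G> :: "'a pair_pre_digraph set"
    and \<F> :: "'b pair_pre_digraph set"
    and \<P> :: "'a rel set"
  assumes "\<forall>G\<in>\<G>. pair_graph G"
    and "forbidden_induced_subgraph_characterization \<G> \<F>"
    and "\<P> = {P. finite_poset P \<and> cover_incomparability_graph P \<in> \<G>}"
  shows "\<exists>\<Q> :: nat rel set. forbidden_cover_preserving_subposet_characterization \<P> \<Q>"
proof -
  have \<F>: "\<And>H. H \<in> \<F> \<Longrightarrow> pair_graph H"
    and \<G>: "\<And>G. pair_graph G \<Longrightarrow> G \<in> \<G> \<longleftrightarrow> \<not> (\<exists>H\<in>\<F>. contains_induced G H)"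
    using assms(2) by (auto simp: forbidden_induced_subgraph_characterization_def)
  define \<Q> :: "nat rel set" where
    "\<Q> = {q. finite_poset q \<and> (\<exists>H\<in>\<F>. contains_induced (cover_incomparability_graph q) H)}"
  have "p \<in> \<P> \<longleftrightarrow> \<not> (\<exists>q\<in>\<Q>. contains_cover_preserving p q)" if p: "finite_poset p" for p
  proof -
    have graph_p: "pair_graph (cover_incomparability_graph p)"
      using p by (rule pair_graph_cover_incomparability_graph)
    \<comment> \<open>Both characterizations negate an existence claim, so it suffices to match the
      two obstructions.\<close>
    have "(\<exists>H\<in>\<F>. contains_induced (cover_incomparability_graph p) H) \<longleftrightarrow>
      (\<exists>q\<in>\<Q>. contains_cover_preserving p q)"
    proof
      assume "\<exists>H\<in>\<F>. contains_induced (cover_incomparability_graph p) H"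
      then obtain H where H: "H \<in> \<F>" "contains_induced (cover_incomparability_graph p) H"
        by blast
      obtain q :: "nat rel" and f where q: "finite_poset q" and iso: "iso p q f"
        using p by (rule finite_poset_iso_nat)
      have "contains_induced (cover_incomparability_graph q) H"
        using H(2) iso_imp_induced_embedding[OF iso]
          pair_graph_cover_incomparability_graph[OF q] \<F>[OF H(1)]
        by (rule contains_induced_embedding_trans)
      with q H(1) have "q \<in> \<Q>" by (auto simp: \<Q>_def)
      \<comment> \<open>Taking \<open>p\<close> as its own subposet turns the isomorphism onto
        \<open>q\<close> into a containment.\<close>
      moreover have "cover_preserving_subposet p p"
        using p by (simp add: cover_preserving_subposet_def finite_poset_def)
      ultimately show "\<exists>q\<in>\<Q>. contains_cover_preserving p q"
        using iso by (auto simp: contains_cover_preserving_def)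
    next
      assume "\<exists>q\<in>\<Q>. contains_cover_preserving p q"
      then obtain q :: "nat rel" and H where H: "H \<in> \<F>"
          "contains_induced (cover_incomparability_graph q) H"
        and pq: "contains_cover_preserving p q"
        unfolding \<Q>_def by blast
      obtain g where
        "induced_embedding g (cover_incomparability_graph q) (cover_incomparability_graph p)"
        using pq by (rule contains_cover_preserving_imp_induced_embedding)
      with H graph_p show "\<exists>H\<in>\<F>. contains_induced (cover_incomparability_graph p) H"
        by (meson \<F> contains_induced_embedding_trans)
    qed
    with p \<G>[OF graph_p] show ?thesis
      by (simp add: assms(3))
  qed
  then have "forbidden_cover_preserving_subposet_characterization \<P> \<Q>"
    by (simp add: forbidden_cover_preserving_subposet_characterization_def \<Q>_def)
  then show ?thesis by blast
qed

end
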